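(* Let $\mathbb{H}$ be a nonzero real Hilbert space and let $T, A_1, A_2, \ldots, A_m \in \mathbb{K}(\mathbb{H})$. Given any $\alpha_1, \alpha_2, \ldots, \alpha_m \in \mathbb{R}$, the operator $\sum_{i=1}^m \alpha_i A_i$ is a best coapproximation to $T$ out of $\mathrm{span}\{A_1, A_2, \ldots, A_m\}$ if and only if for every $\beta_1, \beta_2, \ldots, \beta_m \in \mathbb{R}$ there exists $x \in M_{\sum_{i=1}^m \beta_i A_i}$ such that $$\Big\langle \sum_{i=1}^m \beta_i A_i x,\ \Big(T - \sum_{i=1}^m \alpha_i A_i\Big) x \Big\rangle = 0.$$
   Context: $\mathbb{K}(\mathbb{H})$ is the real Banach space of compact linear operators on the real Hilbert space $\mathbb{H}$ (with inner product $\langle\cdot,\cdot\rangle$ and norm $\|\cdot\|_2$), endowed with the operator norm $\|\cdot\|$. For a bounded linear operator $S$ on $\mathbb{H}$, its norm attainment set is $M_S = \{x \in \mathbb{H} : \|x\|_2 = 1,\ \|Sx\|_2 = \|S\|\}$. For a Banach space $\mathbb{X}$, a subspace $\mathbb{Y}$ of $\mathbb{X}$ and $x \in \mathbb{X}$, an element $y_0 \in \mathbb{Y}$ is a best coapproximation to $x$ out of $\mathbb{Y}$ if $\|y_0 - y\| \le \|x - y\|$ for all $y \in \mathbb{Y}$. *)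

theory Defs
  imports "HOL-Analysis.Analysis"
begin

(* Bounded linear operators are elements of the type of bounded linear functions, whose norm is
   the operator norm.  The space K(H) is a subset of that type and carries the restricted norm. *)

definition compact_operators ::
    "('a::real_normed_vector \<Rightarrow>\<^sub>L 'b::real_normed_vector) set" where
  "compact_operators = {S. compact (closure (blinfun_apply S ` cball 0 1))}"

definition norm_attainment_set ::
    "('a::real_normed_vector \<Rightarrow>\<^sub>L 'b::real_normed_vector) \<Rightarrow> 'a set" where
  "norm_attainment_set S = {x. norm x = 1 \<and> norm (blinfun_apply S x) = norm S}"

(* y0 is a best coapproximation to x out of Y; the notion is meant for a subspace Y.  It involves
   only x and elements of Y, so it does not depend on which space containing these is taken as
   the ambient one (here: K(H) or all bounded operators on H). *)
definition best_coapproximation ::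
    "'a::real_normed_vector set \<Rightarrow> 'a \<Rightarrow> 'a \<Rightarrow> bool" where
  "best_coapproximation Y x y0 \<longleftrightarrow> y0 \<in> Y \<and> (\<forall>y\<in>Y. norm (y0 - y) \<le> norm (x - y))"

end

theory Submission
  imports Defs
begin

text \<open>
  Write \<open>U\<close> for the difference of \<open>T\<close> and the proposed coapproximation.  Substituting \<open>S = y\<^sub>0 - y\<close>
  in the definition turns best coapproximation into \<open>\<parallel>S\<parallel> \<le> \<parallel>S + U\<parallel>\<close> for all \<open>S\<close> in the span.
  As the span is closed under scaling, this says that every such \<open>S\<close> is Birkhoff--James orthogonal
  to \<open>U\<close>, that is, \<open>\<parallel>S\<parallel> \<le> \<parallel>S + t U\<parallel>\<close> for all real \<open>t\<close>.  The theorem is therefore the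
  Bhatia--Semrl criterion, applied to each compact operator \<open>S\<close> of the span:
  \<open>S\<close> is orthogonal to \<open>U\<close> if and only if \<open>\<langle>S x, U x\<rangle> = 0\<close> at some unit vector \<open>x\<close> where \<open>S\<close>
  attains its norm (lemma \<open>birkhoff_james_orthogonal_iff\<close>).

  One direction is Pythagoras at \<open>x\<close>.  For the other, testing orthogonality with small \<open>t > 0\<close>
  at vectors that nearly norm \<open>S + t U\<close> gives unit vectors \<open>x\<^sub>n\<close> with \<open>\<parallel>S x\<^sub>n\<parallel> \<rightarrow> \<parallel>S\<parallel>\<close>
  and with \<open>\<langle>S x\<^sub>n, U x\<^sub>n\<rangle>\<close> bounded below by a null sequence.  A limit point of the \<open>x\<^sub>n\<close> is a
  norm attaining vector at which \<open>\<langle>S x, U x\<rangle> \<ge> 0\<close>; with \<open>-U\<close> for \<open>U\<close> there is also one where it is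
  \<open>\<le> 0\<close>.  The norm attaining vectors are the unit vectors of a subspace, so the intermediate value
  theorem on the segment between the two gives a zero.

  Both the existence of the limit point and the subspace property come from the quadratic form
  \<open>q v = \<parallel>S\<parallel>\<^sup>2 \<parallel>v\<parallel>\<^sup>2 - \<parallel>S v\<parallel>\<^sup>2\<close>.  It is nonnegative and satisfies the parallelogram law, whence
  \<open>q (a - b) \<le> 2 q a + 2 q b\<close>.  Thus the zeros of \<open>q\<close> form a subspace, and
  \<open>\<parallel>S\<parallel>\<^sup>2 \<parallel>a - b\<parallel>\<^sup>2 \<le> \<parallel>S a - S b\<parallel>\<^sup>2 + 2 q a + 2 q b\<close>, so that a norming sequence of unit vectors
  is Cauchy as soon as its images are.
\<close>

section \<open>Compact operators form a subspace\<close>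

lemma compact_operators_if_image_subset_compact:
  assumes "compact K" "blinfun_apply S ` cball 0 1 \<subseteq> K"
  shows "S \<in> compact_operators"
proof -
  have "closure (blinfun_apply S ` cball 0 1) \<subseteq> K"
    using assms by (simp add: closure_minimal compact_imp_closed)
  then have "closure (blinfun_apply S ` cball 0 1) = K \<inter> closure (blinfun_apply S ` cball 0 1)"
    by blast
  then show ?thesis
    unfolding compact_operators_def using assms(1)
    by (metis closed_closure compact_Int_closed mem_Collect_eq)
qed

lemma subspace_compact_operators:
  "subspace (compact_operators :: ('a::real_normed_vector \<Rightarrow>\<^sub>L 'b::real_normed_vector) set)"
proof (rule subspaceI)
  show "(0 :: 'a \<Rightarrow>\<^sub>L 'b) \<in> compact_operators"
    by (rule compact_operators_if_image_subset_compact[of "{0}"]) auto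
next
  fix R S :: "'a \<Rightarrow>\<^sub>L 'b"
  assume "R \<in> compact_operators" "S \<in> compact_operators"
  then have "compact {x + y | x y. x \<in> closure (R ` cball 0 1) \<and> y \<in> closure (S ` cball 0 1)}"
    unfolding compact_operators_def by (blast intro: compact_sums)
  moreover have "(R + S) ` cball 0 1 \<subseteq>
      {x + y | x y. x \<in> closure (R ` cball 0 1) \<and> y \<in> closure (S ` cball 0 1)}"
    using closure_subset[of "R ` cball 0 1"] closure_subset[of "S ` cball 0 1"]
    by (force simp: blinfun.add_left)
  ultimately show "R + S \<in> compact_operators"
    by (rule compact_operators_if_image_subset_compact)
next
  fix c and S :: "'a \<Rightarrow>\<^sub>L 'b"
  assume "S \<in> compact_operators"
  then have "compact ((\<lambda>x. c *\<^sub>R x) ` closure (S ` cball 0 1))"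
    unfolding compact_operators_def by (blast intro: compact_scaling)
  moreover have "(c *\<^sub>R S) ` cball 0 1 \<subseteq> (\<lambda>x. c *\<^sub>R x) ` closure (S ` cball 0 1)"
    using closure_subset[of "S ` cball 0 1"] by (force simp: blinfun.scaleR_left)
  ultimately show "c *\<^sub>R S \<in> compact_operators"
    by (rule compact_operators_if_image_subset_compact)
qed

section \<open>The norm defect of an operator\<close>

definition norm_defect :: "('a::real_inner \<Rightarrow>\<^sub>L 'b::real_inner) \<Rightarrow> 'a \<Rightarrow> real" where
  "norm_defect S v = (norm S)\<^sup>2 * (norm v)\<^sup>2 - (norm (S v))\<^sup>2"

lemma norm_defect_nonneg: "0 \<le> norm_defect S v"
  using power_mono[OF norm_blinfun[of S v] norm_ge_zero, of 2]
  by (simp add: norm_defect_def power_mult_distrib)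

lemma norm_defect_minus: "norm_defect S (- v) = norm_defect S v"
  by (simp add: norm_defect_def blinfun.minus_right)

lemma norm_defect_scaleR: "norm_defect S (c *\<^sub>R v) = c\<^sup>2 * norm_defect S v"
  by (simp add: norm_defect_def blinfun.scaleR_right power_mult_distrib algebra_simps)

text \<open>
  By the parallelogram law in both spaces, \<open>norm_defect S (a - b) + norm_defect S (a + b)\<close> equals the
  right-hand side; the second summand is nonnegative.
\<close>

lemma norm_defect_diff_le:
  "norm_defect S (a - b) \<le> 2 * norm_defect S a + 2 * norm_defect S b"
proof -
  have "norm_defect S (a - b) + norm_defect S (a + b) = 2 * norm_defect S a + 2 * norm_defect S b"
    unfolding norm_defect_def power2_norm_eq_inner blinfun.diff_right blinfun.add_right
    by (simp add: inner_simps inner_commute algebra_simps)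
  then show ?thesis
    using norm_defect_nonneg[of S "a + b"] by linarith
qed

lemma norm_attainment_set_iff_norm_defect:
  "x \<in> norm_attainment_set S \<longleftrightarrow> norm x = 1 \<and> norm_defect S x = 0"
  by (auto simp: norm_attainment_set_def norm_defect_def)

lemma subspace_norm_defect_zero: "subspace {v. norm_defect S v = 0}"
proof (rule subspaceI)
  show "0 \<in> {v. norm_defect S v = 0}"
    by (simp add: norm_defect_def)
next
  fix a b assume "a \<in> {v. norm_defect S v = 0}" "b \<in> {v. norm_defect S v = 0}"
  then show "a + b \<in> {v. norm_defect S v = 0}"
    using norm_defect_diff_le[of S a "- b"] norm_defect_nonneg[of S "a + b"]
    by (simp add: norm_defect_minus)
qed (simp add: norm_defect_scaleR)

section \<open>Norming sequences of a compact operator\<close>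

lemma exists_unit_vector_nearly_norming:
  fixes S :: "'a::real_normed_vector \<Rightarrow>\<^sub>L 'b::real_normed_vector"
  assumes "(UNIV :: 'a set) \<noteq> {0}" and "e > 0"
  shows "\<exists>x. norm x = 1 \<and> norm S - e < norm (S x)"
proof (rule ccontr)
  assume "\<not> ?thesis"
  then have bound: "norm (S x) \<le> norm S - e" if "norm x = 1" for x
    using that by (meson not_less)
  obtain v :: 'a where "v \<noteq> 0"
    using assms(1) by blast
  then have "norm (sgn v) = 1"
    by (simp add: norm_sgn)
  then have nonneg: "0 \<le> norm S - e"
    using bound norm_ge_zero order_trans by blast
  have "norm (S x) \<le> (norm S - e) * norm x" for x
  proof (cases "x = 0")
    case False
    then have "norm (S (sgn x)) \<le> norm S - e"
      by (intro bound) (simp add: norm_sgn)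
    with False show ?thesis
      by (simp add: sgn_div_norm blinfun.scaleR_right field_simps)
  qed simp
  then have "norm S \<le> norm S - e"
    using nonneg by (rule norm_blinfun_bound[rotated])
  with \<open>e > 0\<close> show False by simp
qed

text \<open>
  Compactness makes the images \<open>S (x n)\<close> converge along a subsequence.  The bound on
  \<open>norm_defect S (x m - x n)\<close> then transports the Cauchy property from the images back to the vectors
  themselves, since the defects of the \<open>x n\<close> tend to \<open>0\<close>.
\<close>

lemma norming_sequence_has_convergent_subsequence:
  fixes S :: "'a::{real_inner,complete_space} \<Rightarrow>\<^sub>L 'b::real_inner"
  assumes "S \<in> compact_operators" and "S \<noteq> 0"
    and unit: "\<And>n. norm (x n) = 1"
    and norming: "(\<lambda>n. norm (S (x n))) \<longlonglongrightarrow> norm S"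
  obtains r l where "strict_mono (r :: nat \<Rightarrow> nat)" "(\<lambda>n. x (r n)) \<longlonglongrightarrow> l"
proof -
  have "S (x n) \<in> closure (S ` cball 0 1)" for n
    using unit[of n] by (intro closure_subset[THEN subsetD] imageI) simp
  moreover have "seq_compact (closure (S ` cball 0 1))"
    using assms(1) by (simp add: compact_operators_def compact_imp_seq_compact)
  ultimately obtain r y where r: "strict_mono (r :: nat \<Rightarrow> nat)"
      and "((\<lambda>n. S (x n)) \<circ> r) \<longlonglongrightarrow> y"
    by (blast elim: seq_compactE[of _ "\<lambda>n. S (x n)"])
  then have "(\<lambda>n. S (x (r n))) \<longlonglongrightarrow> y"
    by (simp add: o_def)
  then have Cauchy_image: "Cauchy (\<lambda>n. S (x (r n)))"
    using LIMSEQ_imp_Cauchy by blast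
  have "(\<lambda>n. norm_defect S (x n)) \<longlonglongrightarrow> (norm S)\<^sup>2 * 1\<^sup>2 - (norm S)\<^sup>2"
    unfolding norm_defect_def unit by (intro tendsto_intros norming)
  then have "(\<lambda>n. norm_defect S (x n)) \<longlonglongrightarrow> 0"
    by simp
  from LIMSEQ_subseq_LIMSEQ[OF this r] have defect: "(\<lambda>n. norm_defect S (x (r n))) \<longlonglongrightarrow> 0"
    by (simp add: o_def)
  have "Cauchy (\<lambda>n. x (r n))"
  proof (rule CauchyI)
    fix e :: real assume "e > 0"
    define d where "d = norm S * e"
    have "d > 0"
      using \<open>e > 0\<close> \<open>S \<noteq> 0\<close> by (simp add: d_def)
    obtain M where M: "norm (S (x (r m)) - S (x (r n))) < d / 2" if "m \<ge> M" "n \<ge> M" for m n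
      using CauchyD[OF Cauchy_image, of "d / 2"] \<open>d > 0\<close> by (meson half_gt_zero)
    have "\<forall>\<^sub>F n in sequentially. norm_defect S (x (r n)) < d\<^sup>2 / 8"
      using order_tendstoD(2)[OF defect, of "d\<^sup>2 / 8"] \<open>d > 0\<close> by simp
    then obtain N where N: "norm_defect S (x (r n)) < d\<^sup>2 / 8" if "n \<ge> N" for n
      by (auto simp: eventually_sequentially)
    have "norm (x (r m) - x (r n)) < e" if "m \<ge> max M N" "n \<ge> max M N" for m n
    proof -
      have "(norm S * norm (x (r m) - x (r n)))\<^sup>2
          = (norm (S (x (r m)) - S (x (r n))))\<^sup>2 + norm_defect S (x (r m) - x (r n))"
        by (simp add: norm_defect_def blinfun.diff_right power_mult_distrib)
      also have "\<dots> \<le> (d / 2)\<^sup>2 + (2 * norm_defect S (x (r m)) + 2 * norm_defect S (x (r n)))"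
        using M[of m n] that by (intro add_mono power_mono norm_defect_diff_le) auto
      also have "\<dots> < (d / 2)\<^sup>2 + (2 * (d\<^sup>2 / 8) + 2 * (d\<^sup>2 / 8))"
        using N[of m] N[of n] that by simp
      also have "\<dots> \<le> d\<^sup>2"
        by (simp add: power2_eq_square)
      finally have "norm S * norm (x (r m) - x (r n)) < d"
        using \<open>d > 0\<close> by (auto dest: power2_less_imp_less)
      then show ?thesis
        using \<open>S \<noteq> 0\<close> by (simp add: d_def)
    qed
    then show "\<exists>K. \<forall>m\<ge>K. \<forall>n\<ge>K. norm (x (r m) - x (r n)) < e"
      by blast
  qed
  then obtain l where "(\<lambda>n. x (r n)) \<longlonglongrightarrow> l"
    using Cauchy_convergent_iff convergent_def by blast
  with r show ?thesis ..
qed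

section \<open>Birkhoff--James orthogonality to a compact operator\<close>

text \<open>
  For \<open>t > 0\<close>, a unit vector \<open>x\<close> with \<open>\<parallel>S x + t U x\<parallel> > \<parallel>S\<parallel> - t\<^sup>2\<close> satisfies, on expanding the square,
  \<open>2 t \<langle>S x, U x\<rangle> \<ge> - t\<^sup>2 (\<parallel>U\<parallel>\<^sup>2 + 2 \<parallel>S\<parallel>)\<close>.  The tolerance \<open>t\<^sup>2\<close> is chosen so that dividing by
  \<open>t\<close> still leaves a bound that vanishes with \<open>t\<close>.
\<close>

lemma exists_norm_attaining_inner_nonneg:
  fixes S U :: "'a::{real_inner,complete_space} \<Rightarrow>\<^sub>L 'b::real_inner"
  assumes nontrivial: "(UNIV :: 'a set) \<noteq> {0}"
    and "S \<in> compact_operators" and "S \<noteq> 0"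
    and orth: "\<And>t. t > 0 \<Longrightarrow> norm S \<le> norm (S + t *\<^sub>R U)"
  shows "\<exists>x \<in> norm_attainment_set S. 0 \<le> S x \<bullet> U x"
proof -
  define t :: "nat \<Rightarrow> real" where "t n = inverse (real (Suc n))" for n
  have t_pos: "t n > 0" for n
    by (simp add: t_def)
  have t_lim: "t \<longlonglongrightarrow> 0"
    unfolding t_def by (rule LIMSEQ_inverse_real_of_nat)
  have "\<exists>x. norm x = 1 \<and> norm (S + t n *\<^sub>R U) - (t n)\<^sup>2 < norm ((S + t n *\<^sub>R U) x)" for n
    using t_pos[of n] by (intro exists_unit_vector_nearly_norming nontrivial) simp
  then obtain x where unit: "\<And>n. norm (x n) = 1"
    and near: "\<And>n. norm (S + t n *\<^sub>R U) - (t n)\<^sup>2 < norm ((S + t n *\<^sub>R U) (x n))"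
    by metis
  have large: "norm S - (t n)\<^sup>2 \<le> norm (S (x n) + t n *\<^sub>R U (x n))" for n
    using near[of n] orth[OF t_pos[of n]] by (simp add: blinfun.add_left blinfun.scaleR_left)
  have S_le: "norm (S (x n)) \<le> norm S" and U_le: "norm (U (x n)) \<le> norm U" for n
    using norm_blinfun[of S "x n"] norm_blinfun[of U "x n"] by (simp_all add: unit)

  have "norm S - (t n)\<^sup>2 - t n * norm U \<le> norm (S (x n))" for n
  proof -
    have "norm (S (x n) + t n *\<^sub>R U (x n)) \<le> norm (S (x n)) + t n * norm (U (x n))"
      using norm_triangle_ineq[of "S (x n)" "t n *\<^sub>R U (x n)"] t_pos[of n] by simp
    moreover have "t n * norm (U (x n)) \<le> t n * norm U"
      using U_le t_pos[of n] by simp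
    ultimately show ?thesis
      using large[of n] by linarith
  qed
  then have below: "\<forall>\<^sub>F n in sequentially. norm S - (t n)\<^sup>2 - t n * norm U \<le> norm (S (x n))"
    by (rule always_eventually[OF allI])
  have above: "\<forall>\<^sub>F n in sequentially. norm (S (x n)) \<le> norm S"
    using S_le by (rule always_eventually[OF allI])
  have "(\<lambda>n. norm S - (t n)\<^sup>2 - t n * norm U) \<longlonglongrightarrow> norm S - 0\<^sup>2 - 0 * norm U"
    by (intro tendsto_intros t_lim)
  then have "(\<lambda>n. norm S - (t n)\<^sup>2 - t n * norm U) \<longlonglongrightarrow> norm S"
    by simp
  then have norming: "(\<lambda>n. norm (S (x n))) \<longlonglongrightarrow> norm S"
    using tendsto_const by (rule real_tendsto_sandwich[OF below above])

  have lower: "- t n * ((norm U)\<^sup>2 + 2 * norm S) \<le> 2 * (S (x n) \<bullet> U (x n))" for n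
  proof -
    \<comment> \<open>For \<open>\<parallel>S\<parallel> < t\<^sup>2\<close> the estimate \<open>large\<close> cannot be squared, but then the left-hand side
      \<open>\<parallel>S\<parallel> (\<parallel>S\<parallel> - 2 t\<^sup>2)\<close> is negative.\<close>
    have "(norm S)\<^sup>2 - 2 * (t n)\<^sup>2 * norm S \<le> (norm (S (x n) + t n *\<^sub>R U (x n)))\<^sup>2"
    proof (cases "(t n)\<^sup>2 \<le> norm S")
      case True
      then have "(norm S - (t n)\<^sup>2)\<^sup>2 \<le> (norm (S (x n) + t n *\<^sub>R U (x n)))\<^sup>2"
        using large by (intro power_mono) auto
      moreover have "(norm S)\<^sup>2 - 2 * (t n)\<^sup>2 * norm S \<le> (norm S - (t n)\<^sup>2)\<^sup>2"
        by (simp add: power2_diff)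
      ultimately show ?thesis by linarith
    next
      case False
      then have "norm S * norm S \<le> (t n)\<^sup>2 * norm S"
        by (intro mult_right_mono) auto
      moreover have "0 \<le> (t n)\<^sup>2 * norm S"
        by simp
      ultimately have "(norm S)\<^sup>2 - 2 * (t n)\<^sup>2 * norm S \<le> 0"
        unfolding power2_eq_square[of "norm S"] by linarith
      then show ?thesis
        using zero_le_power2 order_trans by blast
    qed
    also have "\<dots> = (norm (S (x n)))\<^sup>2 + 2 * t n * (S (x n) \<bullet> U (x n)) + (t n)\<^sup>2 * (norm (U (x n)))\<^sup>2"
      unfolding power2_norm_eq_inner
      by (simp add: inner_simps inner_commute power2_eq_square algebra_simps)
    also have "\<dots> \<le> (norm S)\<^sup>2 + 2 * t n * (S (x n) \<bullet> U (x n)) + (t n)\<^sup>2 * (norm U)\<^sup>2"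
      using S_le U_le t_pos[of n] by (intro add_mono mult_left_mono power_mono) auto
    finally have "t n * (- t n * ((norm U)\<^sup>2 + 2 * norm S)) \<le> t n * (2 * (S (x n) \<bullet> U (x n)))"
      by (simp add: power2_eq_square algebra_simps)
    then show ?thesis
      using t_pos[of n] by (simp only: mult_le_cancel_left_pos)
  qed

  obtain r l where r: "strict_mono (r :: nat \<Rightarrow> nat)" and l: "(\<lambda>n. x (r n)) \<longlonglongrightarrow> l"
    using norming_sequence_has_convergent_subsequence[OF assms(2,3) unit norming] .
  have "norm l = 1"
    using tendsto_norm[OF l] by (simp add: unit LIMSEQ_const_iff)
  moreover have "norm (S l) = norm S"
  proof (rule LIMSEQ_unique)
    show "(\<lambda>n. norm (S (x (r n)))) \<longlonglongrightarrow> norm (S l)"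
      by (intro tendsto_intros l)
    show "(\<lambda>n. norm (S (x (r n)))) \<longlonglongrightarrow> norm S"
      using LIMSEQ_subseq_LIMSEQ[OF norming r] by (simp add: o_def)
  qed
  moreover have "0 \<le> S l \<bullet> U l"
  proof -
    have "(\<lambda>n. t (r n)) \<longlonglongrightarrow> 0"
      using LIMSEQ_subseq_LIMSEQ[OF t_lim r] by (simp add: o_def)
    then have "(\<lambda>n. - t (r n) * ((norm U)\<^sup>2 + 2 * norm S)) \<longlonglongrightarrow> - 0 * ((norm U)\<^sup>2 + 2 * norm S)"
      by (intro tendsto_intros)
    moreover have "(\<lambda>n. 2 * (S (x (r n)) \<bullet> U (x (r n)))) \<longlonglongrightarrow> 2 * (S l \<bullet> U l)"
      by (intro tendsto_intros l)
    ultimately have "- 0 * ((norm U)\<^sup>2 + 2 * norm S) \<le> 2 * (S l \<bullet> U l)"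
      by (rule LIMSEQ_le) (intro exI allI impI lower)
    then show ?thesis by simp
  qed
  ultimately show ?thesis
    by (auto simp: norm_attainment_set_def)
qed

text \<open>
  The segment between \<open>x\<close> and \<open>z\<close> consists of vectors without norm defect.  It avoids the origin
  unless \<open>z = - x\<close>, in which case the quadratic expression takes the same value at both ends.
\<close>

lemma exists_norm_attaining_inner_zero:
  fixes S U :: "'a::real_inner \<Rightarrow>\<^sub>L 'b::real_inner"
  assumes x: "x \<in> norm_attainment_set S" "0 \<le> S x \<bullet> U x"
    and z: "z \<in> norm_attainment_set S" "S z \<bullet> U z \<le> 0"
  shows "\<exists>v \<in> norm_attainment_set S. S v \<bullet> U v = 0"
proof (cases "z = - x")
  case True
  then have "S x \<bullet> U x = 0"
    using x(2) z(2) by (simp add: blinfun.minus_right)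
  with x(1) show ?thesis by blast
next
  case False
  define v where "v u = (1 - u) *\<^sub>R x + u *\<^sub>R z" for u :: real
  have "continuous_on {0..1} (\<lambda>u. S (v u) \<bullet> U (v u))"
    unfolding v_def by (intro continuous_intros)
  then obtain u where u: "0 \<le> u" "u \<le> 1" and zero: "S (v u) \<bullet> U (v u) = 0"
    using IVT2'[of "\<lambda>u. S (v u) \<bullet> U (v u)" 1 0 0] x(2) z(2) by (auto simp: v_def)
  have "norm x = 1" "norm z = 1"
    using x z by (auto simp: norm_attainment_set_def)
  have "v u \<noteq> 0"
  proof
    assume "v u = 0"
    then have eq: "u *\<^sub>R z = - ((1 - u) *\<^sub>R x)"
      by (simp add: v_def eq_neg_iff_add_eq_0 add.commute)
    then have "norm (u *\<^sub>R z) = norm ((1 - u) *\<^sub>R x)"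
      by simp
    then have "u = 1 / 2"
      using u \<open>norm x = 1\<close> \<open>norm z = 1\<close> by simp
    with eq have "(1 / 2 :: real) *\<^sub>R z = (1 / 2 :: real) *\<^sub>R (- x)"
      by simp
    with False show False
      unfolding scaleR_cancel_left by simp
  qed
  have "norm_defect S (v u) = 0"
    using subspace_norm_defect_zero[of S] x(1) z(1)
    unfolding v_def norm_attainment_set_iff_norm_defect
    by (metis (mono_tags, lifting) mem_Collect_eq subspace_add subspace_scale)
  then have "sgn (v u) \<in> norm_attainment_set S"
    using \<open>v u \<noteq> 0\<close>
    by (simp add: norm_attainment_set_iff_norm_defect norm_sgn)
       (simp add: sgn_div_norm norm_defect_scaleR)
  moreover have "S (sgn (v u)) \<bullet> U (sgn (v u)) = 0"
    using zero by (simp add: sgn_div_norm blinfun.scaleR_right)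
  ultimately show ?thesis by blast
qed

lemma norm_le_norm_add_if_inner_zero:
  fixes S U :: "'a::real_inner \<Rightarrow>\<^sub>L 'b::real_inner"
  assumes "x \<in> norm_attainment_set S" and "S x \<bullet> U x = 0"
  shows "norm S \<le> norm (S + U)"
proof -
  have unit: "norm x = 1" and attain: "norm (S x) = norm S"
    using assms(1) by (auto simp: norm_attainment_set_def)
  have "(norm (S x + U x))\<^sup>2 = (norm (S x))\<^sup>2 + (norm (U x))\<^sup>2"
    using assms(2) by (simp add: power2_norm_eq_inner inner_simps inner_commute)
  then have "(norm (S x))\<^sup>2 \<le> (norm (S x + U x))\<^sup>2"
    by simp
  then have "norm (S x) \<le> norm (S x + U x)"
    by (rule power2_le_imp_le) simp
  also have "\<dots> \<le> norm (S + U)"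
    using norm_blinfun[of "S + U" x] by (simp add: unit blinfun.add_left)
  finally show ?thesis
    by (simp add: attain)
qed

lemma birkhoff_james_orthogonal_iff:
  fixes S U :: "'a::{real_inner,complete_space} \<Rightarrow>\<^sub>L 'b::real_inner"
  assumes nontrivial: "(UNIV :: 'a set) \<noteq> {0}" and compact: "S \<in> compact_operators"
  shows "(\<forall>t. norm S \<le> norm (S + t *\<^sub>R U)) \<longleftrightarrow> (\<exists>x \<in> norm_attainment_set S. S x \<bullet> U x = 0)"
proof
  assume orth: "\<forall>t. norm S \<le> norm (S + t *\<^sub>R U)"
  show "\<exists>x \<in> norm_attainment_set S. S x \<bullet> U x = 0"
  proof (cases "S = 0")
    case True
    obtain v :: 'a where "v \<noteq> 0"
      using nontrivial by blast
    with True have "sgn v \<in> norm_attainment_set S" "S (sgn v) \<bullet> U (sgn v) = 0"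
      by (simp_all add: norm_attainment_set_def norm_sgn)
    then show ?thesis by blast
  next
    case False
    have "norm S \<le> norm (S + t *\<^sub>R (- U))" for t
      using orth[rule_format, of "- t"] by simp
    then have "\<exists>z \<in> norm_attainment_set S. 0 \<le> S z \<bullet> (- U) z"
      by (intro exists_norm_attaining_inner_nonneg[OF nontrivial compact False])
    then obtain z where z: "z \<in> norm_attainment_set S" "S z \<bullet> U z \<le> 0"
      by (auto simp: blinfun.minus_left)
    have "\<exists>x \<in> norm_attainment_set S. 0 \<le> S x \<bullet> U x"
      by (rule exists_norm_attaining_inner_nonneg[OF nontrivial compact False orth[rule_format]])
    then obtain x where "x \<in> norm_attainment_set S" "0 \<le> S x \<bullet> U x"
      by blast
    then show ?thesis
      using z by (rule exists_norm_attaining_inner_zero)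
  qed
next
  assume "\<exists>x \<in> norm_attainment_set S. S x \<bullet> U x = 0"
  then obtain x where x: "x \<in> norm_attainment_set S" "S x \<bullet> U x = 0"
    by blast
  have "norm S \<le> norm (S + t *\<^sub>R U)" for t
    using x(2) by (intro norm_le_norm_add_if_inner_zero[OF x(1)]) (simp add: blinfun.scaleR_left)
  then show "\<forall>t. norm S \<le> norm (S + t *\<^sub>R U)"
    by (rule allI)
qed

section \<open>Best coapproximation from a span\<close>

lemma span_image_eq_range_linear_combinations:
  fixes A :: "'i \<Rightarrow> 'a::real_vector"
  assumes "finite I"
  shows "span (A ` I) = range (\<lambda>\<beta>. \<Sum>i\<in>I. \<beta> i *\<^sub>R A i)"
proof (rule span_unique)
  show "A ` I \<subseteq> range (\<lambda>\<beta>. \<Sum>i\<in>I. \<beta> i *\<^sub>R A i)"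
  proof (rule image_subsetI)
    fix j assume "j \<in> I"
    then have "A j = (\<Sum>i\<in>I. if i = j then A i else 0)"
      using assms by simp
    also have "\<dots> = (\<Sum>i\<in>I. (if i = j then 1 else 0) *\<^sub>R A i)"
      by (intro sum.cong) auto
    finally show "A j \<in> range (\<lambda>\<beta>. \<Sum>i\<in>I. \<beta> i *\<^sub>R A i)"
      by (intro range_eqI[of _ _ "\<lambda>i. if i = j then 1 else 0"])
  qed
  show "subspace (range (\<lambda>\<beta>. \<Sum>i\<in>I. \<beta> i *\<^sub>R A i))"
  proof (rule subspaceI)
    show "0 \<in> range (\<lambda>\<beta>. \<Sum>i\<in>I. \<beta> i *\<^sub>R A i)"
      by (rule range_eqI[of _ _ "\<lambda>i. 0"]) simp
  next
    fix x y
    assume "x \<in> range (\<lambda>\<beta>. \<Sum>i\<in>I. \<beta> i *\<^sub>R A i)" "y \<in> range (\<lambda>\<beta>. \<Sum>i\<in>I. \<beta> i *\<^sub>R A i)"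
    then obtain \<beta> \<gamma> where "x = (\<Sum>i\<in>I. \<beta> i *\<^sub>R A i)" "y = (\<Sum>i\<in>I. \<gamma> i *\<^sub>R A i)"
      by blast
    then show "x + y \<in> range (\<lambda>\<beta>. \<Sum>i\<in>I. \<beta> i *\<^sub>R A i)"
      by (intro range_eqI[of _ _ "\<lambda>i. \<beta> i + \<gamma> i"]) (simp add: scaleR_add_left sum.distrib)
  next
    fix c x
    assume "x \<in> range (\<lambda>\<beta>. \<Sum>i\<in>I. \<beta> i *\<^sub>R A i)"
    then obtain \<beta> where "x = (\<Sum>i\<in>I. \<beta> i *\<^sub>R A i)"
      by blast
    then show "c *\<^sub>R x \<in> range (\<lambda>\<beta>. \<Sum>i\<in>I. \<beta> i *\<^sub>R A i)"
      by (intro range_eqI[of _ _ "\<lambda>i. c * \<beta> i"]) (simp add: scaleR_sum_right)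
  qed
  show "range (\<lambda>\<beta>. \<Sum>i\<in>I. \<beta> i *\<^sub>R A i) \<subseteq> V" if "A ` I \<subseteq> V" "subspace V" for V
    using that by (auto intro!: subspace_sum subspace_scale)
qed

text \<open>
  The substitution \<open>s = y\<^sub>0 - y\<close> is a bijection of the subspace and turns \<open>x - y\<close> into
  \<open>s + (x - y\<^sub>0)\<close>; a factor \<open>t \<noteq> 0\<close> is absorbed by replacing \<open>s\<close> with \<open>s / t\<close>.
\<close>

lemma best_coapproximation_iff_birkhoff_james_orthogonal:
  assumes Y: "subspace Y" and y0: "y0 \<in> Y"
  shows "best_coapproximation Y x y0 \<longleftrightarrow> (\<forall>s\<in>Y. \<forall>t. norm s \<le> norm (s + t *\<^sub>R (x - y0)))"
proof
  assume best: "best_coapproximation Y x y0"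
  have le: "norm s \<le> norm (s + (x - y0))" if "s \<in> Y" for s
  proof -
    have "y0 - s \<in> Y"
      using Y y0 that by (rule subspace_diff)
    then have "norm (y0 - (y0 - s)) \<le> norm (x - (y0 - s))"
      using best unfolding best_coapproximation_def by blast
    then show ?thesis
      by (simp add: algebra_simps)
  qed
  show "\<forall>s\<in>Y. \<forall>t. norm s \<le> norm (s + t *\<^sub>R (x - y0))"
  proof (intro ballI allI)
    fix s t assume "s \<in> Y"
    show "norm s \<le> norm (s + t *\<^sub>R (x - y0))"
    proof (cases "t = 0")
      case False
      have "norm s = \<bar>t\<bar> * norm (s /\<^sub>R t)"
        using False by simp
      also have "\<dots> \<le> \<bar>t\<bar> * norm (s /\<^sub>R t + (x - y0))"
        using \<open>s \<in> Y\<close> Y by (intro mult_left_mono le subspace_scale) auto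
      also have "\<dots> = norm (t *\<^sub>R (s /\<^sub>R t + (x - y0)))"
        by simp
      also have "t *\<^sub>R (s /\<^sub>R t + (x - y0)) = s + t *\<^sub>R (x - y0)"
        using False by (simp add: scaleR_add_right)
      finally show ?thesis .
    qed simp
  qed
next
  assume orth: "\<forall>s\<in>Y. \<forall>t. norm s \<le> norm (s + t *\<^sub>R (x - y0))"
  have "norm (y0 - y) \<le> norm (x - y)" if "y \<in> Y" for y
    using orth[rule_format, of "y0 - y" 1] subspace_diff[OF Y y0 that] by simp
  with y0 show "best_coapproximation Y x y0"
    by (simp add: best_coapproximation_def)
qed

theorem theorem2p1:
  fixes T :: "'h::{real_inner,complete_space} \<Rightarrow>\<^sub>L 'h"
    and A :: "nat \<Rightarrow> ('h \<Rightarrow>\<^sub>L 'h)"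
    and m :: nat
    and \<alpha> :: "nat \<Rightarrow> real"
  assumes "(UNIV :: 'h set) \<noteq> {0}"
    and "T \<in> compact_operators"
    and "\<And>i. i \<in> {1..m} \<Longrightarrow> A i \<in> compact_operators"
  shows "best_coapproximation (span (A ` {1..m})) T (\<Sum>i=1..m. \<alpha> i *\<^sub>R A i) \<longleftrightarrow>
    (\<forall>\<beta> :: nat \<Rightarrow> real.
      \<exists>x \<in> norm_attainment_set (\<Sum>i=1..m. \<beta> i *\<^sub>R A i).
        blinfun_apply (\<Sum>i=1..m. \<beta> i *\<^sub>R A i) x \<bullet>
        blinfun_apply (T - (\<Sum>i=1..m. \<alpha> i *\<^sub>R A i)) x = 0)"
proof -
  define U where "U = T - (\<Sum>i=1..m. \<alpha> i *\<^sub>R A i)"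
  have span: "span (A ` {1..m}) = range (\<lambda>\<beta>. \<Sum>i=1..m. \<beta> i *\<^sub>R A i)"
    by (rule span_image_eq_range_linear_combinations) simp
  have compact: "S \<in> compact_operators" if "S \<in> span (A ` {1..m})" for S
    using that span_minimal[OF _ subspace_compact_operators] assms(3) by blast
  have "best_coapproximation (span (A ` {1..m})) T (\<Sum>i=1..m. \<alpha> i *\<^sub>R A i)
      \<longleftrightarrow> (\<forall>S\<in>span (A ` {1..m}). \<forall>t. norm S \<le> norm (S + t *\<^sub>R U))"
    unfolding U_def
    by (intro best_coapproximation_iff_birkhoff_james_orthogonal subspace_span)
       (unfold span, rule rangeI)
  also have "\<dots> \<longleftrightarrow> (\<forall>S\<in>span (A ` {1..m}). \<exists>x \<in> norm_attainment_set S. S x \<bullet> U x = 0)"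
    by (intro ball_cong refl birkhoff_james_orthogonal_iff assms(1) compact)
  also have "\<dots> \<longleftrightarrow> (\<forall>\<beta>. \<exists>x \<in> norm_attainment_set (\<Sum>i=1..m. \<beta> i *\<^sub>R A i).
      (\<Sum>i=1..m. \<beta> i *\<^sub>R A i) x \<bullet> U x = 0)"
    unfolding span by simp
  finally show ?thesis
    unfolding U_def .
qed

end
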